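(* Let $\theta_t\in[-\pi,\pi)^N$ evolve by the ACCA dynamics with periodic boundary conditions. Fix $t$ and suppose that the edge $(k,k+1)$ is updated. Define the two sums \[ S^{(t)}_\pm(k):=\delta_t(k\pm1)+\tfrac12\,\delta_t(k). \] Then \[ W_{t+1}=W_t-(m_-+m_+),\qquad \operatorname{wrap}_\pi\big(S^{(t)}_\pm(k)\big)=S^{(t)}_\pm(k)-2\pi m_\pm, \] with suitable $m_\pm\in\{-1,0,1\}$. In particular, \[ W_{t+1}=W_t\quad\Longleftrightarrow\quad S^{(t)}_\pm(k)\in(-\pi,\pi)\ \text{ (for both signs)}. \]
   Context: Let $N\ge2$. For $a\in\mathbb R$ let $\operatorname{wrap}_\pi(a):=a-2\pi\lfloor\frac{a+\pi}{2\pi}\rfloor\in[-\pi,\pi)$. Periodic boundary conditions mean that the vertices $1,\dots,N$ form a ring with the $N$ edges $(1,2),\dots,(N-1,N),(N,1)$, and all indices are read modulo $N$ (so $N+1\equiv1$, $0\equiv N$). For a configuration $\theta_t\in[-\pi,\pi)^N$ put $\delta_t(i):=\operatorname{wrap}_\pi(\theta_t(i+1)-\theta_t(i))\in[-\pi,\pi)$, $1\le i\le N$, and define the winding number $W_t:=\frac1{2\pi}\sum_{i=1}^N\delta_t(i)$ (an integer). The ACCA dynamics (asynchronous continuous-state cellular automaton) is the following discrete-time Markov process on $[-\pi,\pi)^N$, started from an initial configuration $\theta_0$. At each step an edge $(k,k+1)$ of the ring is chosen uniformly at random and only the two values at its endpoints are updated, by \[ \theta_{t+1}(k)=\operatorname{wrap}_\pi\big(\theta_t(k)+\tfrac12\delta_t(k)\big),\qquad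 \theta_{t+1}(k+1)=\operatorname{wrap}_\pi\big(\theta_t(k+1)-\tfrac12\delta_t(k)\big), \] so that both endpoints move to the midpoint of the shortest arc between them and $\theta_{t+1}(k)=\theta_{t+1}(k+1)$; all other values are kept. If $\delta_t(k)=-\pi$, the two endpoints are antipodal and there are two possible shortest-arc midpoints on the circle; in this case one of them is chosen with probability $1/2$ each, and both endpoints move to it.
   Formalization: If δ_t(k) = −π, it is assumed that N ≥ 3 and that the midpoint of the displayed formula is chosen; the final equivalence with (−π,π) is stated for S_± ≠ −π, and with [−π,π) without that restriction. The claim fails in the excluded ties. *)

theory Defs
  imports "HOL-Probability.Probability"
begin

definition wrap_pi :: "real \<Rightarrow> real" where
  "wrap_pi a = a - 2 * pi * of_int \<lfloor>(a + pi) / (2 * pi)\<rfloor>"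

(* Vertices of the ring are 1, ..., N. *)
definition ring_next :: "nat \<Rightarrow> nat \<Rightarrow> nat" where
  "ring_next N i = (if i = N then 1 else i + 1)"

definition ring_prev :: "nat \<Rightarrow> nat \<Rightarrow> nat" where
  "ring_prev N i = (if i = 1 then N else i - 1)"

definition configs :: "nat \<Rightarrow> (nat \<Rightarrow> real) set" where
  "configs N = {1..N} \<rightarrow>\<^sub>E {-pi..<pi}"

definition edge_diff :: "nat \<Rightarrow> (nat \<Rightarrow> real) \<Rightarrow> nat \<Rightarrow> real" where
  "edge_diff N \<theta> i = wrap_pi (\<theta> (ring_next N i) - \<theta> i)"

definition winding :: "nat \<Rightarrow> (nat \<Rightarrow> real) \<Rightarrow> real" where
  "winding N \<theta> = 1 / (2 * pi) * (\<Sum>i = 1..N. edge_diff N \<theta> i)"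

definition S_plus :: "nat \<Rightarrow> (nat \<Rightarrow> real) \<Rightarrow> nat \<Rightarrow> real" where
  "S_plus N \<theta> k = edge_diff N \<theta> (ring_next N k) + 1 / 2 * edge_diff N \<theta> k"

definition S_minus :: "nat \<Rightarrow> (nat \<Rightarrow> real) \<Rightarrow> nat \<Rightarrow> real" where
  "S_minus N \<theta> k = edge_diff N \<theta> (ring_prev N k) + 1 / 2 * edge_diff N \<theta> k"

(* Update of the edge (k, k+1). The coin c matters only for antipodal endpoints, where
   edge_diff = -pi: if c holds, the usual formula is applied with displacement -pi; otherwise
   it is applied with displacement pi, which moves both endpoints to the other midpoint. *)
definition acca_update ::
  "nat \<Rightarrow> nat \<Rightarrow> bool \<Rightarrow> (nat \<Rightarrow> real) \<Rightarrow> (nat \<Rightarrow> real)" where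
  "acca_update N k c \<theta> =
     (let d = (if edge_diff N \<theta> k = - pi \<and> \<not> c then pi else edge_diff N \<theta> k)
      in \<theta>(k := wrap_pi (\<theta> k + 1 / 2 * d),
           ring_next N k := wrap_pi (\<theta> (ring_next N k) - 1 / 2 * d)))"

(* K t is the edge (K t, K t + 1) chosen at step t and C t the tie-breaking coin of step t.
   The pairs (K t, C t) are i.i.d., uniform on the edges times a fair coin, so \<Theta> is the
   ACCA Markov chain started from \<theta>0. *)
locale acca_process = prob_space M for M :: "'w measure" +
  fixes N :: nat
    and \<theta>0 :: "nat \<Rightarrow> real"
    and K :: "nat \<Rightarrow> 'w \<Rightarrow> nat"
    and C :: "nat \<Rightarrow> 'w \<Rightarrow> bool"
    and \<Theta> :: "nat \<Rightarrow> 'w \<Rightarrow> (nat \<Rightarrow> real)"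
  assumes initial_config: "\<theta>0 \<in> configs N"
    and edge_range: "\<And>t \<omega>. \<omega> \<in> space M \<Longrightarrow> K t \<omega> \<in> {1..N}"
    and choices_indep:
      "indep_vars (\<lambda>_. count_space UNIV) (\<lambda>t \<omega>. (K t \<omega>, C t \<omega>)) UNIV"
    and choices_distr:
      "\<And>t. distr M (count_space UNIV) (\<lambda>\<omega>. (K t \<omega>, C t \<omega>)) =
            measure_pmf (pair_pmf (pmf_of_set {1..N}) (bernoulli_pmf (1 / 2)))"
    and \<Theta>_0: "\<And>\<omega>. \<omega> \<in> space M \<Longrightarrow> \<Theta> 0 \<omega> = \<theta>0"
    and \<Theta>_Suc: "\<And>t \<omega>. \<omega> \<in> space M \<Longrightarrow>
      \<Theta> (Suc t) \<omega> = acca_update N (K t \<omega>) (C t \<omega>) (\<Theta> t \<omega>)"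

end

theory Submission
  imports Defs
begin

text \<open>
  Since \<open>wrap_pi\<close> is \<open>2\<pi>\<close>-periodic, the update replaces the edge differences at \<open>k - 1\<close>, \<open>k\<close>,
  \<open>k + 1\<close> by \<open>wrap_pi S\<^sub>-\<close>, \<open>0\<close>, \<open>wrap_pi S\<^sub>+\<close>, whereas before the update they summed to
  \<open>S\<^sub>- + S\<^sub>+\<close>. A nonzero \<open>m\<^sub>-\<close> or \<open>m\<^sub>+\<close> has the sign of the difference at \<open>k\<close>, so \<open>m\<^sub>-\<close> and \<open>m\<^sub>+\<close>
  cannot cancel. On the two-vertex ring, where the tie hypothesis excludes antipodal
  endpoints, the edges \<open>k - 1\<close> and \<open>k + 1\<close> coincide and \<open>m\<^sub>-\<close>, \<open>m\<^sub>+\<close>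
  and both winding numbers vanish.
\<close>

text \<open>The values of this turn count at \<open>S_minus\<close> and \<open>S_plus\<close> serve
  as the integers m of the theorem.\<close>

definition wrap_count :: "real \<Rightarrow> int" where
  "wrap_count a = \<lfloor>(a + pi) / (2 * pi)\<rfloor>"

lemma wrap_pi_eq: "wrap_pi a = a - 2 * pi * of_int (wrap_count a)"
  by (simp add: wrap_pi_def wrap_count_def)

lemma wrap_count_unique:
  assumes "- pi \<le> a - 2 * pi * of_int n" "a - 2 * pi * of_int n < pi"
  shows "wrap_count a = n"
  unfolding wrap_count_def using assms by (intro floor_unique) (simp_all add: field_simps)

lemma wrap_pi_range: "- pi \<le> wrap_pi a" "wrap_pi a < pi"
proof -
  have "of_int (wrap_count a) \<le> (a + pi) / (2 * pi)" "(a + pi) / (2 * pi) < of_int (wrap_count a) + 1"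
    unfolding wrap_count_def by linarith+
  then show "- pi \<le> wrap_pi a" "wrap_pi a < pi"
    by (simp_all add: wrap_pi_eq field_simps)
qed

lemma wrap_pi_unique:
  assumes "- pi \<le> b" "b < pi" "a - b = 2 * pi * of_int n"
  shows "wrap_pi a = b"
proof -
  have "wrap_count a = n"
    using assms by (intro wrap_count_unique) linarith+
  then show ?thesis
    using assms(3) by (simp add: wrap_pi_eq)
qed

lemma wrap_pi_cong:
  assumes "a - b = 2 * pi * of_int n"
  shows "wrap_pi a = wrap_pi b"
proof (rule wrap_pi_unique)
  show "a - wrap_pi b = 2 * pi * of_int (n + wrap_count b)"
    using assms by (simp add: wrap_pi_eq algebra_simps)
qed (rule wrap_pi_range)+

text \<open>Negation preserves the open interval from \<open>- pi\<close> to \<open>pi\<close>. The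
  value \<open>- pi\<close> is excluded because its negative \<open>pi\<close> is outside the
  half-open range.\<close>

lemma wrap_pi_uminus:
  assumes "wrap_pi a \<noteq> - pi"
  shows "wrap_pi (- a) = - wrap_pi a"
proof (rule wrap_pi_unique)
  show "- a - - wrap_pi a = 2 * pi * of_int (- wrap_count a)"
    by (simp add: wrap_pi_eq)
qed (use assms wrap_pi_range[of a] in linarith)+

lemma wrap_count_eq_0_iff: "wrap_count a = 0 \<longleftrightarrow> a \<in> {- pi..<pi}"
  using wrap_pi_range[of a] wrap_count_unique[of a 0] by (auto simp: wrap_pi_eq)

text \<open>The shift by half of \<open>d\<close> is at most \<open>pi / 2\<close> in size, so the
  sum can leave the range only on the side given by the sign of \<open>d\<close>, and by less than
  one turn. This one-sidedness later rules out cancellation.\<close>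

lemma wrap_count_add_half:
  assumes "- pi \<le> x" "x < pi" "- pi \<le> d" "d < pi"
  shows "wrap_count (x + 1 / 2 * d) \<in> (if 0 \<le> d then {0, 1} else {- 1, 0})"
proof (cases "x + 1 / 2 * d \<in> {- pi..<pi}")
  case True
  then have "wrap_count (x + 1 / 2 * d) = 0"
    by (simp only: wrap_count_eq_0_iff)
  then show ?thesis
    by simp
next
  case False
  show ?thesis
  proof (cases "0 \<le> d")
    case True
    then have "wrap_count (x + 1 / 2 * d) = 1"
      using assms False by (intro wrap_count_unique) auto
    then show ?thesis using True by simp
  next
    case d: False
    then have "wrap_count (x + 1 / 2 * d) = - 1"
      using assms False by (intro wrap_count_unique) auto
    then show ?thesis using d by simp
  qed
qed

lemma edge_diff_eq:
  "edge_diff N \<theta> i = \<theta> (ring_next N i) - \<theta> i - 2 * pi * of_int (wrap_count (\<theta> (ring_next N i) - \<theta> i))"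
  by (simp add: edge_diff_def wrap_pi_eq)

lemma edge_diff_range: "- pi \<le> edge_diff N \<theta> i" "edge_diff N \<theta> i < pi"
  by (simp_all add: edge_diff_def wrap_pi_range)

lemma wrap_count_S:
  "wrap_count (S_minus N \<theta> k) \<in> (if 0 \<le> edge_diff N \<theta> k then {0, 1} else {- 1, 0})"
  "wrap_count (S_plus N \<theta> k) \<in> (if 0 \<le> edge_diff N \<theta> k then {0, 1} else {- 1, 0})"
  unfolding S_minus_def S_plus_def by (rule wrap_count_add_half edge_diff_range)+

text \<open>An inner wrap shifts by a multiple of \<open>2 * pi\<close>, which the outer wrap
  absorbs. This and the next two lemmas let updated, hence wrapped, angles be handled as plain
  reals.\<close>

lemma wrap_pi_diff_wrap_pi: "wrap_pi (wrap_pi a - b) = wrap_pi (a - b)"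
  by (rule wrap_pi_cong[where n = "- wrap_count a"]) (simp add: wrap_pi_eq)

lemma wrap_pi_diff_wrap_pi_right: "wrap_pi (a - wrap_pi b) = wrap_pi (a - b)"
  by (rule wrap_pi_cong[where n = "wrap_count b"]) (simp add: wrap_pi_eq)

lemma wrap_pi_wrap_pi_add: "wrap_pi (wrap_pi a + b) = wrap_pi (a + b)"
  by (rule wrap_pi_cong[where n = "- wrap_count a"]) (simp add: wrap_pi_eq)

text \<open>In a tie the coin \<open>c\<close> selects the displacement \<open>- pi\<close>, which
  is \<open>edge_diff\<close> itself, so one formula covers all cases.\<close>

lemma acca_update_displacement:
  assumes "edge_diff N \<theta> k = - pi \<Longrightarrow> c"
  shows "acca_update N k c \<theta> =
    \<theta>(k := wrap_pi (\<theta> k + 1 / 2 * edge_diff N \<theta> k),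
      ring_next N k := wrap_pi (\<theta> (ring_next N k) - 1 / 2 * edge_diff N \<theta> k))"
  using assms by (auto simp: acca_update_def Let_def)

lemma edge_diff_acca_update_same:
  assumes "2 \<le> N" "k \<in> {1..N}" and tie: "edge_diff N \<theta> k = - pi \<Longrightarrow> c"
  shows "edge_diff N (acca_update N k c \<theta>) k = 0"
proof -
  define d where "d = edge_diff N \<theta> k"
  have "ring_next N k \<noteq> k"
    using assms(1,2) by (auto simp: ring_next_def)
  moreover have "acca_update N k c \<theta> =
      \<theta>(k := wrap_pi (\<theta> k + 1 / 2 * d), ring_next N k := wrap_pi (\<theta> (ring_next N k) - 1 / 2 * d))"
    unfolding d_def by (rule acca_update_displacement) (rule tie)
  ultimately have "edge_diff N (acca_update N k c \<theta>) k =
      wrap_pi (\<theta> (ring_next N k) - 1 / 2 * d - (\<theta> k + 1 / 2 * d))"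
    by (simp add: edge_diff_def wrap_pi_diff_wrap_pi wrap_pi_diff_wrap_pi_right)
  also have "\<dots> = 0"
    \<comment> \<open>The raw difference exceeds \<open>d\<close> by exactly this many turns, so
      what remains after subtracting \<open>d\<close> wraps to 0.\<close>
    by (rule wrap_pi_unique[where n = "wrap_count (\<theta> (ring_next N k) - \<theta> k)"])
       (simp_all add: d_def edge_diff_eq)
  finally show ?thesis .
qed

lemma winding_acca_update_ge_3:
  assumes N: "3 \<le> N" and k: "k \<in> {1..N}" and tie: "edge_diff N \<theta> k = - pi \<Longrightarrow> c"
  shows "winding N (acca_update N k c \<theta>) =
    winding N \<theta> - of_int (wrap_count (S_minus N \<theta> k) + wrap_count (S_plus N \<theta> k))"
proof -
  define \<theta>' where "\<theta>' = acca_update N k c \<theta>"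
  define d where "d = edge_diff N \<theta> k"
  define p where "p = ring_prev N k"
  define n where "n = ring_next N k"
  have \<theta>': "\<theta>' = \<theta>(k := wrap_pi (\<theta> k + 1 / 2 * d), n := wrap_pi (\<theta> n - 1 / 2 * d))"
    unfolding \<theta>'_def d_def n_def by (rule acca_update_displacement) (rule tie)
  \<comment> \<open>\<open>3 \<le> N\<close> makes \<open>p\<close> and \<open>n\<close> distinct
    and keeps the far end of edge \<open>n\<close> away from \<open>k\<close>. For
    \<open>N = 3\<close> that end is \<open>p\<close>, which does not move.\<close>
  have ring: "p \<in> {1..N}" "n \<in> {1..N}" "p \<noteq> k" "n \<noteq> k" "p \<noteq> n" "ring_next N p = k"
      "ring_next N n \<noteq> k" "ring_next N n \<noteq> n"
    using N k by (auto simp: p_def n_def ring_prev_def ring_next_def split: if_splits)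
  have "edge_diff N \<theta>' p = wrap_pi (\<theta> k - \<theta> p + 1 / 2 * d)"
    using ring by (simp add: edge_diff_def \<theta>' wrap_pi_diff_wrap_pi algebra_simps)
  also have "\<dots> = wrap_pi (S_minus N \<theta> k)"
    using ring by (simp add: S_minus_def p_def[symmetric] d_def[symmetric] edge_diff_def[of N \<theta> p]
        wrap_pi_wrap_pi_add)
  finally have diff_p: "edge_diff N \<theta>' p = wrap_pi (S_minus N \<theta> k)" .
  have "edge_diff N \<theta>' n = wrap_pi (\<theta> (ring_next N n) - \<theta> n + 1 / 2 * d)"
    using ring by (simp add: edge_diff_def \<theta>' wrap_pi_diff_wrap_pi_right algebra_simps)
  also have "\<dots> = wrap_pi (S_plus N \<theta> k)"
    by (simp add: S_plus_def n_def[symmetric] d_def[symmetric] edge_diff_def[of N \<theta> n]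
        wrap_pi_wrap_pi_add)
  finally have diff_n: "edge_diff N \<theta>' n = wrap_pi (S_plus N \<theta> k)" .
  have diff_k: "edge_diff N \<theta>' k = 0"
    unfolding \<theta>'_def using N k tie by (intro edge_diff_acca_update_same) auto
  \<comment> \<open>Only the vertices \<open>k\<close> and \<open>n\<close> move, and every edge
    touching one of them is among \<open>p\<close>, \<open>k\<close>, \<open>n\<close>.\<close>
  have diff_rest: "(\<Sum>i \<in> {1..N} - {p, k, n}. edge_diff N \<theta>' i) = (\<Sum>i \<in> {1..N} - {p, k, n}. edge_diff N \<theta> i)"
  proof (rule sum.cong[OF refl])
    fix i assume i: "i \<in> {1..N} - {p, k, n}"
    then have "ring_next N i \<noteq> k" "ring_next N i \<noteq> n"
      using k by (auto simp: p_def n_def ring_prev_def ring_next_def split: if_splits)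
    with i show "edge_diff N \<theta>' i = edge_diff N \<theta> i"
      by (simp add: edge_diff_def \<theta>')
  qed
  have split: "(\<Sum>i = 1..N. f i) = f p + f k + f n + (\<Sum>i \<in> {1..N} - {p, k, n}. f i)"
    for f :: "nat \<Rightarrow> real"
    using ring k by (subst sum.subset_diff[of "{p, k, n}"]) auto
  have "(\<Sum>i = 1..N. edge_diff N \<theta>' i) =
      wrap_pi (S_minus N \<theta> k) + wrap_pi (S_plus N \<theta> k) + (\<Sum>i \<in> {1..N} - {p, k, n}. edge_diff N \<theta> i)"
    unfolding split diff_p diff_n diff_k diff_rest by simp
  \<comment> \<open>Before the update the three differences add up to
    \<open>S_minus + S_plus\<close>: the middle one is split into halves, one for each neighbouring
    edge.\<close>
  also have "\<dots> = (\<Sum>i = 1..N. edge_diff N \<theta> i) -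
      2 * pi * of_int (wrap_count (S_minus N \<theta> k) + wrap_count (S_plus N \<theta> k))"
    unfolding split wrap_pi_eq
    by (simp add: S_minus_def S_plus_def p_def n_def algebra_simps)
  finally show ?thesis
    by (simp add: winding_def \<theta>'_def field_simps)
qed

text \<open>The two edges join the same pair of vertices in opposite directions.\<close>

lemma two_ring_edge_diff:
  assumes "k \<in> {1..2}" "edge_diff 2 \<theta> k \<noteq> - pi"
  shows "edge_diff 2 \<theta> (ring_next 2 k) = - edge_diff 2 \<theta> k"
proof -
  have "ring_next 2 (ring_next 2 k) = k"
    using assms(1) by (auto simp: ring_next_def)
  then show ?thesis
    using wrap_pi_uminus[of "\<theta> (ring_next 2 k) - \<theta> k"] assms(2) by (simp add: edge_diff_def)
qed

lemma two_ring_winding: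
  assumes "k \<in> {1..2}" "edge_diff 2 \<theta> k \<noteq> - pi"
  shows "winding 2 \<theta> = 0"
proof -
  have "{1..2} = {k, ring_next 2 k}" "ring_next 2 k \<noteq> k"
    using assms(1) by (auto simp: ring_next_def)
  then show ?thesis
    using two_ring_edge_diff[OF assms] by (simp add: winding_def)
qed

text \<open>Both neighbours of edge \<open>k\<close> are the one other edge, whose difference is the
  negative of that at \<open>k\<close>. Each sum is thus minus half a difference, too small to
  wrap.\<close>

lemma two_ring_wrap_count:
  assumes "k \<in> {1..2}" "edge_diff 2 \<theta> k \<noteq> - pi"
  shows "wrap_count (S_minus 2 \<theta> k) = 0" "wrap_count (S_plus 2 \<theta> k) = 0"
proof -
  have "ring_prev 2 k = ring_next 2 k"
    using assms(1) by (auto simp: ring_prev_def ring_next_def)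
  then have "S_minus 2 \<theta> k = - (1 / 2 * edge_diff 2 \<theta> k)" "S_plus 2 \<theta> k = - (1 / 2 * edge_diff 2 \<theta> k)"
    using two_ring_edge_diff[OF assms] by (simp_all add: S_minus_def S_plus_def)
  then show "wrap_count (S_minus 2 \<theta> k) = 0" "wrap_count (S_plus 2 \<theta> k) = 0"
    using edge_diff_range[of 2 \<theta> k] by (simp_all add: wrap_count_eq_0_iff)
qed

lemma winding_acca_update:
  assumes N: "2 \<le> N" and k: "k \<in> {1..N}" and tie: "edge_diff N \<theta> k = - pi \<Longrightarrow> 3 \<le> N \<and> c"
  shows "winding N (acca_update N k c \<theta>) =
    winding N \<theta> - of_int (wrap_count (S_minus N \<theta> k) + wrap_count (S_plus N \<theta> k))"
proof (cases "N = 2")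
  case True
  then have k2: "k \<in> {1..2}" and d: "edge_diff 2 \<theta> k \<noteq> - pi"
    using k tie by auto
  \<comment> \<open>The new difference 0 is not \<open>- pi\<close>, so
    \<open>two_ring_winding\<close> applies after the update as well as before.\<close>
  have "edge_diff 2 (acca_update 2 k c \<theta>) k = 0"
    using k2 d by (intro edge_diff_acca_update_same) auto
  then show ?thesis
    using two_ring_winding[OF k2] two_ring_wrap_count[OF k2 d] d True by simp
next
  case False
  with N k tie show ?thesis
    by (intro winding_acca_update_ge_3) auto
qed

theorem theorem4p1:
  fixes N :: nat and M :: "'w measure" and \<theta>0 :: "nat \<Rightarrow> real"
    and K :: "nat \<Rightarrow> 'w \<Rightarrow> nat" and C :: "nat \<Rightarrow> 'w \<Rightarrow> bool"
    and \<Theta> :: "nat \<Rightarrow> 'w \<Rightarrow> (nat \<Rightarrow> real)"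
    and t k :: nat and \<omega> :: 'w
  assumes "2 \<le> N"
    and "acca_process M N \<theta>0 K C \<Theta>"
    and "\<omega> \<in> space M"
    and "K t \<omega> = k"
    and tie: "edge_diff N (\<Theta> t \<omega>) k = - pi \<Longrightarrow> 3 \<le> N \<and> C t \<omega>"
  shows
    "(\<exists>m_minus m_plus :: int.
        m_minus \<in> {-1, 0, 1} \<and> m_plus \<in> {-1, 0, 1} \<and>
        winding N (\<Theta> (Suc t) \<omega>) = winding N (\<Theta> t \<omega>) - of_int (m_minus + m_plus) \<and>
        wrap_pi (S_minus N (\<Theta> t \<omega>) k) = S_minus N (\<Theta> t \<omega>) k - 2 * pi * of_int m_minus \<and>
        wrap_pi (S_plus N (\<Theta> t \<omega>) k) = S_plus N (\<Theta> t \<omega>) k - 2 * pi * of_int m_plus)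
     \<and> (S_minus N (\<Theta> t \<omega>) k \<noteq> - pi \<and> S_plus N (\<Theta> t \<omega>) k \<noteq> - pi \<longrightarrow>
          (winding N (\<Theta> (Suc t) \<omega>) = winding N (\<Theta> t \<omega>) \<longleftrightarrow>
             S_minus N (\<Theta> t \<omega>) k \<in> {-pi<..<pi} \<and> S_plus N (\<Theta> t \<omega>) k \<in> {-pi<..<pi}))
     \<and> (winding N (\<Theta> (Suc t) \<omega>) = winding N (\<Theta> t \<omega>) \<longleftrightarrow>
          S_minus N (\<Theta> t \<omega>) k \<in> {-pi..<pi} \<and> S_plus N (\<Theta> t \<omega>) k \<in> {-pi..<pi})"
proof -
  interpret acca_process M N \<theta>0 K C \<Theta> by fact
  define \<theta> where "\<theta> = \<Theta> t \<omega>"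
  define m where "m = wrap_count (S_minus N \<theta> k)"
  define m' where "m' = wrap_count (S_plus N \<theta> k)"
  have k: "k \<in> {1..N}"
    using edge_range[OF \<open>\<omega> \<in> space M\<close>, of t] \<open>K t \<omega> = k\<close> by simp
  have "\<Theta> (Suc t) \<omega> = acca_update N k (C t \<omega>) \<theta>"
    using \<Theta>_Suc[OF \<open>\<omega> \<in> space M\<close>] \<open>K t \<omega> = k\<close> by (simp add: \<theta>_def)
  then have winding: "winding N (\<Theta> (Suc t) \<omega>) = winding N \<theta> - of_int (m + m')"
    using winding_acca_update[OF \<open>2 \<le> N\<close> k, of \<theta> "C t \<omega>"] tie by (simp add: \<theta>_def m_def m'_def)
  have signs: "m \<in> {0, 1} \<and> m' \<in> {0, 1} \<or> m \<in> {- 1, 0} \<and> m' \<in> {- 1, 0}"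
    using wrap_count_S[where N = N and \<theta> = \<theta> and k = k] by (simp add: m_def m'_def split: if_splits)
  \<comment> \<open>Integers of weakly equal sign sum to 0 only if both vanish.\<close>
  then have "m + m' = 0 \<longleftrightarrow> m = 0 \<and> m' = 0"
    by auto
  then have "winding N (\<Theta> (Suc t) \<omega>) = winding N \<theta> \<longleftrightarrow> m = 0 \<and> m' = 0"
    unfolding winding by (simp flip: of_int_add)
  \<comment> \<open>The interval is half-open since \<open>wrap_pi\<close> fixes
    \<open>- pi\<close>; the open version below follows once both sums avoid that endpoint.\<close>
  then have iff: "winding N (\<Theta> (Suc t) \<omega>) = winding N \<theta> \<longleftrightarrow>
      S_minus N \<theta> k \<in> {- pi..<pi} \<and> S_plus N \<theta> k \<in> {- pi..<pi}"
    by (simp only: m_def m'_def wrap_count_eq_0_iff)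
  have ex: "m \<in> {- 1, 0, 1} \<and> m' \<in> {- 1, 0, 1} \<and>
      winding N (\<Theta> (Suc t) \<omega>) = winding N \<theta> - of_int (m + m') \<and>
      wrap_pi (S_minus N \<theta> k) = S_minus N \<theta> k - 2 * pi * of_int m \<and>
      wrap_pi (S_plus N \<theta> k) = S_plus N \<theta> k - 2 * pi * of_int m'"
    using signs winding by (auto simp: m_def m'_def wrap_pi_eq)
  show ?thesis
    unfolding \<theta>_def[symmetric]
  proof (intro conjI impI)
    show "winding N (\<Theta> (Suc t) \<omega>) = winding N \<theta> \<longleftrightarrow>
        S_minus N \<theta> k \<in> {- pi<..<pi} \<and> S_plus N \<theta> k \<in> {- pi<..<pi}"
      if "S_minus N \<theta> k \<noteq> - pi \<and> S_plus N \<theta> k \<noteq> - pi"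
      using that unfolding iff by auto
  qed (use ex iff in blast)+
qed

end
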